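(* Let $L\in\mathbb{N}^+$. Suppose that for every $\omega\in\Omega$ and every $l=1,\dots,L$ one has $\|q(\omega;\cdot,t_1)-q_{\Delta x_l,\Delta t_l}(\omega;\cdot,t_1)\|_{L^1(D)}\le C_w(\Delta x_l)^2$, with a constant $C_w$ independent of $\omega$ and $l$. Then for any $M_l\in\mathbb{N}^+$, $l=1,\dots,L$, at time $t=t_1$ ($0<t_1<\infty$), $$\big\|\mathbb{E}[q(\omega;\mathbf{x},t_1)]-E^L[q_{\Delta x_L,\Delta t_L}(\omega;\mathbf{x},t_1)]\big\|_{L^2(\Omega;L^1(D))}\le C_w(\Delta x_L)^2+|D|^{\frac12}\sum_{l=1}^{L}M_l^{-\frac12}\,\big\|\mathbb{V}[Y_l]\big\|_{L^1(D)}^{\frac12},$$ where $E^L[\cdot]$ is the multilevel Monte Carlo estimator and $Y_l$ are the level differences (both defined in the context).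
   Context: **BGK equation with random initial data.** $(\Omega,\mathscr{F},\mathbb{P})$ is a probability space, $D\subset\mathbb{R}^3$ is a bounded domain with Lebesgue measure $|D|$, with periodic boundary conditions. For a random initial datum $f_0(\omega;\mathbf{x},\mathbf{v})\ge0$ and fixed $\varepsilon>0$, $f(\omega;\mathbf{x},\mathbf{v},t)$ is the solution of $$\partial_t f+\mathbf{v}\cdot\nabla_{\mathbf{x}}f=\tfrac1\varepsilon(M[f]-f),\quad f|_{t=0}=f_0,\quad M[f]=\frac{\rho}{(2\pi T)^{3/2}}\exp\Big(-\frac{|\mathbf{v}-\mathbf{U}|^2}{2T}\Big),$$ $$\rho=\int_{\mathbb{R}^3}f\,d\mathbf{v},\quad \mathbf{U}=\frac1\rho\int_{\mathbb{R}^3}\mathbf{v}f\,d\mathbf{v},\quad T=\frac1{3\rho}\int_{\mathbb{R}^3}|\mathbf{v}-\mathbf{U}|^2f\,d\mathbf{v}.$$ The problem is assumed well-posed for each $\omega$. The letter $q=q(\omega;\mathbf{x},t)$ denotes any one of $\rho$, $|\mathbf{U}|$, $T$. **Norms and moments.** $\|X\|_{L^2(\Omega;L^1(D))}=(\mathbb{E}[\|X\|_{L^1(D)}^2])^{1/2}$. Expectations and variances are taken pointwise in $\mathbf{x}$: $\mathbb{V}[X](\mathbf{x})=\mathbb{E}[X(\mathbf{x})^2]-(\mathbb{E}[X(\mathbf{x})])^2$. The relevant expectations are assumed to exist; if a right-hand side is infinite the inequality is trivially true. **Numerical solutions.** A deterministic scheme for the BGK equation (second order in time and space, with $\Delta t\le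 C\Delta x$; velocity discretization error ignored) is applied separately for each $\omega$. $q_{\Delta x,\Delta t}(\omega;\mathbf{x},t)$ denotes the resulting approximation of $q$ computed from $f_0(\omega;\cdot,\cdot)$ with mesh size $\Delta x$ and time step $\Delta t$. **MLMC estimator.** There are $L$ nested meshes with mesh sizes $\Delta x_l$ decreasing in $l$ and corresponding time steps $\Delta t_l$, $l=1,\dots,L$. Set $q_{\Delta x_0,\Delta t_0}:=0$ and $Y_l:=q_{\Delta x_l,\Delta t_l}-q_{\Delta x_{l-1},\Delta t_{l-1}}$. At level $l$ one draws $M_l$ i.i.d. samples $f_0^i$ of $f_0$, and $Y_l^i:=q^i_{\Delta x_l,\Delta t_l}-q^i_{\Delta x_{l-1},\Delta t_{l-1}}$, $i=1,\dots,M_l$, are the corresponding i.i.d. copies of $Y_l$ (both terms are computed from the same sample $f_0^i$). The estimator is $$E^L[q_{\Delta x_L,\Delta t_L}]:=\sum_{l=1}^{L}E_{M_l}[Y_l]=\sum_{l=1}^{L}\frac1{M_l}\sum_{i=1}^{M_l}Y_l^i.$$ *)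

theory Defs
  imports "HOL-Probability.Probability"
begin

type_synonym vec3 = "real ^ 3"

text \<open>Initial data are functions of \<open>(x, v)\<close>, kinetic densities functions of \<open>(x, v, t)\<close>.\<close>

type_synonym datum = "vec3 \<Rightarrow> vec3 \<Rightarrow> real"
type_synonym kinetic = "vec3 \<Rightarrow> vec3 \<Rightarrow> real \<Rightarrow> real"

section \<open>Bounded domains with periodic boundary conditions\<close>

definition lattice_of :: "vec3 set \<Rightarrow> vec3 set" where
  "lattice_of B = {w. \<exists>k :: vec3 \<Rightarrow> int. w = (\<Sum>b\<in>B. of_int (k b) *\<^sub>R b)}"

text \<open>Periodic boundary conditions make sense on a bounded domain whose translates under a lattice
  of full rank (with basis \<open>B\<close>) tile the space, e.g. on a box with \<open>B\<close> its three edge vectors.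
  Functions on \<open>D\<close> with periodic boundary conditions are then represented by \<open>B\<close>-periodic functions
  on the whole space.\<close>

definition periodic_domain :: "vec3 set \<Rightarrow> vec3 set \<Rightarrow> bool" where
  "periodic_domain D B \<longleftrightarrow>
     open D \<and> connected D \<and> bounded D \<and> D \<noteq> {} \<and>
     independent B \<and> card B = 3 \<and>
     (\<forall>w \<in> lattice_of B - {0}. D \<inter> (+) w ` D = {}) \<and>
     (\<Union>w \<in> lattice_of B. (+) w ` closure D) = UNIV"

section \<open>The BGK equation\<close>

definition mass_density :: "kinetic \<Rightarrow> vec3 \<Rightarrow> real \<Rightarrow> real" where
  "mass_density f x t = (\<integral>v. f x v t \<partial>lborel)"

definition velocity :: "kinetic \<Rightarrow> vec3 \<Rightarrow> real \<Rightarrow> vec3" where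
  "velocity f x t = (1 / mass_density f x t) *\<^sub>R (\<integral>v. f x v t *\<^sub>R v \<partial>lborel)"

definition speed :: "kinetic \<Rightarrow> vec3 \<Rightarrow> real \<Rightarrow> real" where
  "speed f x t = norm (velocity f x t)"

definition temperature :: "kinetic \<Rightarrow> vec3 \<Rightarrow> real \<Rightarrow> real" where
  "temperature f x t =
     1 / (3 * mass_density f x t) * (\<integral>v. (norm (v - velocity f x t))\<^sup>2 * f x v t \<partial>lborel)"

definition maxwellian :: "kinetic \<Rightarrow> vec3 \<Rightarrow> vec3 \<Rightarrow> real \<Rightarrow> real" where
  "maxwellian f x v t =
     mass_density f x t / (2 * pi * temperature f x t) powr (3 / 2) *
     exp (- (norm (v - velocity f x t))\<^sup>2 / (2 * temperature f x t))"

text \<open>Classical solutions. The integrability and positivity conditions say that the moments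
  and the Maxwellian are given by genuine integrals and quotients (no totalised values). In the
  last conjunct, \<open>g\<close> is the gradient in \<open>x\<close> and \<open>d\<close> the partial derivative in \<open>t\<close>.\<close>

definition bgk_solution :: "real \<Rightarrow> vec3 set \<Rightarrow> datum \<Rightarrow> kinetic \<Rightarrow> bool" where
  "bgk_solution \<epsilon> B g0 f \<longleftrightarrow>
     (\<forall>x v t. \<forall>b\<in>B. t \<ge> 0 \<longrightarrow> f (x + b) v t = f x v t) \<and>
     (\<forall>x v. f x v 0 = g0 x v) \<and>
     (\<forall>x v. continuous_on {0..} (f x v)) \<and>
     (\<forall>x t. t > 0 \<longrightarrow>
        integrable lborel (\<lambda>v. f x v t) \<and>
        integrable lborel (\<lambda>v. (norm v)\<^sup>2 * f x v t) \<and>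
        mass_density f x t > 0 \<and> temperature f x t > 0) \<and>
     (\<forall>x v t. t > 0 \<longrightarrow>
        (\<exists>g d. ((\<lambda>(y, s). f y v s) has_derivative (\<lambda>(h, \<tau>). g \<bullet> h + d * \<tau>)) (at (x, t)) \<and>
               d + v \<bullet> g = 1 / \<epsilon> * (maxwellian f x v t - f x v t)))"

text \<open>Existence and uniqueness in a class \<open>X\<close> of kinetic densities. Only times \<open>t \<ge> 0\<close> matter.\<close>

definition bgk_well_posed :: "kinetic set \<Rightarrow> real \<Rightarrow> vec3 set \<Rightarrow> datum \<Rightarrow> bool" where
  "bgk_well_posed X \<epsilon> B g0 \<longleftrightarrow>
     (\<exists>f\<in>X. bgk_solution \<epsilon> B g0 f \<and>
        (\<forall>h\<in>X. bgk_solution \<epsilon> B g0 h \<longrightarrow> (\<forall>x v t. t \<ge> 0 \<longrightarrow> h x v t = f x v t)))"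

section \<open>Norms and moments\<close>

text \<open>All norms and variances take values in \<open>[0, \<infinity>]\<close>, so that an inequality with an infinite
  right-hand side is true.\<close>

definition ennreal_sqrt :: "ennreal \<Rightarrow> ennreal" where
  "ennreal_sqrt a = (if a = \<infinity> then \<infinity> else ennreal (sqrt (enn2real a)))"

definition L1_norm :: "vec3 set \<Rightarrow> (vec3 \<Rightarrow> real) \<Rightarrow> ennreal" where
  "L1_norm D u = (\<integral>\<^sup>+x. ennreal \<bar>u x\<bar> \<partial>lebesgue_on D)"

definition L2_L1_norm :: "'w measure \<Rightarrow> vec3 set \<Rightarrow> ('w \<Rightarrow> vec3 \<Rightarrow> real) \<Rightarrow> ennreal" where
  "L2_L1_norm P D Z = ennreal_sqrt (\<integral>\<^sup>+\<omega>. (L1_norm D (Z \<omega>))\<^sup>2 \<partial>P)"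

text \<open>The variance \<open>E[Z\<^sup>2] - (E[Z])\<^sup>2\<close> of a random variable with finite expectation; it is \<open>\<infinity>\<close>
  if the second moment is. (The library's \<open>variance\<close> is \<open>0\<close> in that case.)\<close>

definition evariance :: "'w measure \<Rightarrow> ('w \<Rightarrow> real) \<Rightarrow> ennreal" where
  "evariance P Z = (\<integral>\<^sup>+\<omega>. ennreal ((Z \<omega>)\<^sup>2) \<partial>P) - ennreal ((\<integral>\<omega>. Z \<omega> \<partial>P)\<^sup>2)"

text \<open>The \<open>L\<^sup>1(D)\<close> norm of \<open>x \<mapsto> V[Z](x)\<close>; no absolute value is needed, the variance being
  \<open>[0, \<infinity>]\<close>-valued.\<close>

definition L1_norm_variance :: "'w measure \<Rightarrow> vec3 set \<Rightarrow> ('w \<Rightarrow> vec3 \<Rightarrow> real) \<Rightarrow> ennreal" where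
  "L1_norm_variance P D Z = (\<integral>\<^sup>+x. evariance P (\<lambda>\<omega>. Z \<omega> x) \<partial>lebesgue_on D)"

section \<open>Meshes, numerical solutions and the multilevel Monte Carlo estimator\<close>

definition is_mesh :: "vec3 set \<Rightarrow> vec3 set set \<Rightarrow> bool" where
  "is_mesh D T \<longleftrightarrow> finite T \<and> T \<subseteq> sets lebesgue \<and> partition_on D T"

definition mesh_size :: "vec3 set set \<Rightarrow> real" where
  "mesh_size T = Max (diameter ` T)"

text \<open>A deterministic scheme maps a mesh, a time step and an initial datum to an approximation,
  as a function of \<open>(x, t)\<close>, of the macroscopic quantity under consideration.\<close>

type_synonym scheme = "vec3 set set \<Rightarrow> real \<Rightarrow> datum \<Rightarrow> vec3 \<Rightarrow> real \<Rightarrow> real"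

text \<open>In the following, level \<open>l\<close> uses the mesh \<open>T l\<close> and the time step \<open>dt l\<close>.\<close>

definition level_sol ::
  "scheme \<Rightarrow> (nat \<Rightarrow> vec3 set set) \<Rightarrow> (nat \<Rightarrow> real) \<Rightarrow> nat \<Rightarrow> datum \<Rightarrow> vec3 \<Rightarrow> real \<Rightarrow> real" where
  "level_sol A T dt l g x t = (if l = 0 then 0 else A (T l) (dt l) g x t)"

definition level_diff ::
  "scheme \<Rightarrow> (nat \<Rightarrow> vec3 set set) \<Rightarrow> (nat \<Rightarrow> real) \<Rightarrow> nat \<Rightarrow> datum \<Rightarrow> vec3 \<Rightarrow> real \<Rightarrow> real" where
  "level_diff A T dt l g x t = level_sol A T dt l g x t - level_sol A T dt (l - 1) g x t"

text \<open>\<open>F l i\<close> is the \<open>i\<close>-th of the \<open>M l\<close> samples of the initial datum drawn at level \<open>l\<close>.\<close>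

definition mlmc_estimator ::
  "scheme \<Rightarrow> (nat \<Rightarrow> vec3 set set) \<Rightarrow> (nat \<Rightarrow> real) \<Rightarrow> nat \<Rightarrow> (nat \<Rightarrow> nat) \<Rightarrow>
   (nat \<Rightarrow> nat \<Rightarrow> 'w \<Rightarrow> datum) \<Rightarrow> 'w \<Rightarrow> vec3 \<Rightarrow> real \<Rightarrow> real" where
  "mlmc_estimator A T dt L M F \<omega> x t =
     (\<Sum>l = 1..L. 1 / real (M l) * (\<Sum>i = 1..M l. level_diff A T dt l (F l i \<omega>) x t))"

text \<open>\<open>Z 1, \<dots>, Z n\<close> are i.i.d. samples of the \<open>S\<close>-valued random variable \<open>Z0\<close> over \<open>P\<close>.\<close>

definition iid_samples ::
  "'w measure \<Rightarrow> 'd measure \<Rightarrow> ('w \<Rightarrow> 'd) \<Rightarrow> nat \<Rightarrow> (nat \<Rightarrow> 'w \<Rightarrow> 'd) \<Rightarrow> bool" where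
  "iid_samples P S Z0 n Z \<longleftrightarrow>
     prob_space.indep_vars P (\<lambda>_. S) Z {1..n} \<and> (\<forall>i\<in>{1..n}. distr P S (Z i) = distr P S Z0)"

end

theory Submission
  imports Defs
begin

text \<open>Almost everywhere in \<open>x\<close> the error splits into the bias \<open>E[q] - E[q\<^sub>L]\<close> and the
  sampling errors \<open>E[Y\<^sub>l] - E\<^sub>M[Y\<^sub>l]\<close> of the levels, because \<open>E[q\<^sub>L]\<close> telescopes. By
  Minkowski's inequality the levels can be treated one at a time. The bias is at most
  \<open>E\<parallel>q - q\<^sub>L\<parallel>\<close>. For a sampling error, Cauchy--Schwarz on \<open>D\<close> bounds the squared \<open>L\<^sup>1\<close> norm
  by \<open>|D|\<close> times the squared \<open>L\<^sup>2\<close> norm, and by Tonelli the mean of the latter is the integral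
  over \<open>D\<close> of the variance of a sample mean, \<open>V[Y\<^sub>l] / M\<^sub>l\<close>.\<close>

section \<open>Square roots and Minkowski's inequality in \<open>ennreal\<close>\<close>

lemma power2_ennreal_le_iff: "a\<^sup>2 \<le> b\<^sup>2 \<longleftrightarrow> a \<le> b" for a b :: ennreal
proof
  assume "a\<^sup>2 \<le> b\<^sup>2"
  then show "a \<le> b"
    by (cases a b rule: ennreal2_cases) (auto simp: ennreal_power power2_le_iff_abs_le top_unique)
qed (rule power_mono, auto)

lemma ennreal_sqrt_power2 [simp]: "(ennreal_sqrt a)\<^sup>2 = a"
  by (cases a) (auto simp: ennreal_sqrt_def ennreal_power)

text \<open>Squaring is strictly increasing on \<open>ennreal\<close>, infinity included, so a bound
  on a root can be checked by squaring both sides.\<close>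

lemma ennreal_sqrt_le_iff: "ennreal_sqrt a \<le> b \<longleftrightarrow> a \<le> b\<^sup>2"
  by (metis ennreal_sqrt_power2 power2_ennreal_le_iff)

lemma ennreal_sqrt_mono: "a \<le> b \<Longrightarrow> ennreal_sqrt a \<le> ennreal_sqrt b"
  by (simp add: ennreal_sqrt_le_iff)

lemma power2_ennreal_eq_iff: "a\<^sup>2 = b\<^sup>2 \<longleftrightarrow> a = b" for a b :: ennreal
  by (metis order.antisym order.refl power2_ennreal_le_iff)

lemma ennreal_sqrt_of_power2 [simp]: "ennreal_sqrt (a\<^sup>2) = a"
  by (metis ennreal_sqrt_power2 power2_ennreal_eq_iff)

lemma ennreal_sqrt_mult: "ennreal_sqrt (a * b) = ennreal_sqrt a * ennreal_sqrt b"
  by (metis ennreal_sqrt_power2 ennreal_sqrt_of_power2 power_mult_distrib)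

lemma ennreal_sqrt_ennreal: "0 \<le> r \<Longrightarrow> ennreal_sqrt (ennreal r) = ennreal (r powr (1 / 2))"
  by (simp add: ennreal_sqrt_def powr_half_sqrt)

text \<open>Expanding the square leaves a cross term, which Cauchy-Schwarz bounds by the product of
  the two roots; the bound is again a perfect square. Nothing is subtracted or divided, so infinite
  values are covered.\<close>

lemma Minkowski_nn_integral_power2:
  assumes [measurable]: "a \<in> borel_measurable N" "b \<in> borel_measurable N"
  shows "ennreal_sqrt (\<integral>\<^sup>+x. (a x + b x)\<^sup>2 \<partial>N)
    \<le> ennreal_sqrt (\<integral>\<^sup>+x. (a x)\<^sup>2 \<partial>N) + ennreal_sqrt (\<integral>\<^sup>+x. (b x)\<^sup>2 \<partial>N)"
proof -
  let ?I = "\<integral>\<^sup>+x. (a x)\<^sup>2 \<partial>N" and ?J = "\<integral>\<^sup>+x. (b x)\<^sup>2 \<partial>N" and ?K = "\<integral>\<^sup>+x. a x * b x \<partial>N"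
  have "?K\<^sup>2 \<le> (ennreal_sqrt ?I * ennreal_sqrt ?J)\<^sup>2"
    using Cauchy_Schwarz_nn_integral[of a N b] by (simp add: power_mult_distrib)
  then have K: "?K \<le> ennreal_sqrt ?I * ennreal_sqrt ?J"
    by (simp only: power2_ennreal_le_iff)
  have "(\<integral>\<^sup>+x. (a x + b x)\<^sup>2 \<partial>N) = (\<integral>\<^sup>+x. (a x)\<^sup>2 + (b x)\<^sup>2 + 2 * (a x * b x) \<partial>N)"
    by (simp add: power2_sum mult.assoc)
  also have "\<dots> = ?I + ?J + 2 * ?K"
    by (simp add: nn_integral_add nn_integral_cmult)
  also have "\<dots> \<le> ?I + ?J + 2 * (ennreal_sqrt ?I * ennreal_sqrt ?J)"
    by (intro add_left_mono mult_left_mono K) auto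
  also have "\<dots> = (ennreal_sqrt ?I + ennreal_sqrt ?J)\<^sup>2"
    by (simp add: power2_sum mult.assoc)
  finally show ?thesis
    by (simp add: ennreal_sqrt_le_iff)
qed

section \<open>Measurability and triangle inequalities for the norms\<close>

lemma sigma_finite_lebesgue_on: "D \<in> lmeasurable \<Longrightarrow> sigma_finite_measure (lebesgue_on D)"
  using finite_measure_lebesgue_on finite_measure_def by blast

text \<open>Minkowski's inequality over \<open>P\<close> asks for this. An integral depends
  measurably on a parameter when the integrand is jointly measurable and the inner measure
  sigma-finite.\<close>

lemma borel_measurable_L1_norm:
  assumes "D \<in> lmeasurable"
    and [measurable]: "(\<lambda>(\<omega>, x). u \<omega> x) \<in> borel_measurable (P \<Otimes>\<^sub>M lebesgue_on D)"
  shows "(\<lambda>\<omega>. L1_norm D (u \<omega>)) \<in> borel_measurable P"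
proof -
  interpret sigma_finite_measure "lebesgue_on D"
    by (rule sigma_finite_lebesgue_on) fact
  show ?thesis
    unfolding L1_norm_def by measurable
qed

lemma L1_norm_triangle:
  assumes "u \<in> borel_measurable (lebesgue_on D)" "v \<in> borel_measurable (lebesgue_on D)"
  shows "L1_norm D (\<lambda>x. u x + v x) \<le> L1_norm D u + L1_norm D v"
proof -
  have "L1_norm D (\<lambda>x. u x + v x) \<le> (\<integral>\<^sup>+x. ennreal \<bar>u x\<bar> + ennreal \<bar>v x\<bar> \<partial>lebesgue_on D)"
    unfolding L1_norm_def by (intro nn_integral_mono) (simp flip: ennreal_plus)
  also have "\<dots> = L1_norm D u + L1_norm D v"
    unfolding L1_norm_def using assms by (intro nn_integral_add) auto
  finally show ?thesis .
qed

text \<open>One null set serves all \<omega>, so each \<open>L1_norm\<close> is unchanged. The error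
  decomposition holds in this form: it involves expectations, which exist only for almost every
  x.\<close>

lemma L2_L1_norm_cong_AE:
  assumes "AE x in lebesgue_on D. \<forall>\<omega>\<in>space P. u \<omega> x = v \<omega> x"
  shows "L2_L1_norm P D u = L2_L1_norm P D v"
proof -
  have "L1_norm D (u \<omega>) = L1_norm D (v \<omega>)" if "\<omega> \<in> space P" for \<omega>
    unfolding L1_norm_def using assms that by (intro nn_integral_cong_AE) auto
  then show ?thesis
    unfolding L2_L1_norm_def by (simp cong: nn_integral_cong)
qed

text \<open>Meant for the bias, which does not depend on \<omega>: over total mass one the root
  undoes the square.\<close>

lemma L2_L1_norm_const:
  assumes "prob_space P"
  shows "L2_L1_norm P D (\<lambda>\<omega>. u) = L1_norm D u"
  using prob_space.emeasure_space_1[OF assms] by (simp add: L2_L1_norm_def)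

text \<open>The norm is iterated, so two inequalities combine: the triangle inequality of
  \<open>L1_norm\<close> for fixed \<omega>, then Minkowski's over \<open>P\<close>.\<close>

lemma L2_L1_norm_triangle:
  assumes D: "D \<in> lmeasurable"
    and u [measurable]: "(\<lambda>(\<omega>, x). u \<omega> x) \<in> borel_measurable (P \<Otimes>\<^sub>M lebesgue_on D)"
    and v [measurable]: "(\<lambda>(\<omega>, x). v \<omega> x) \<in> borel_measurable (P \<Otimes>\<^sub>M lebesgue_on D)"
  shows "L2_L1_norm P D (\<lambda>\<omega> x. u \<omega> x + v \<omega> x) \<le> L2_L1_norm P D u + L2_L1_norm P D v"
proof -
  have "L1_norm D (\<lambda>x. u \<omega> x + v \<omega> x) \<le> L1_norm D (u \<omega>) + L1_norm D (v \<omega>)"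
    if [measurable]: "\<omega> \<in> space P" for \<omega>
    by (rule L1_norm_triangle) measurable
  then have "L2_L1_norm P D (\<lambda>\<omega> x. u \<omega> x + v \<omega> x)
      \<le> ennreal_sqrt (\<integral>\<^sup>+\<omega>. (L1_norm D (u \<omega>) + L1_norm D (v \<omega>))\<^sup>2 \<partial>P)"
    unfolding L2_L1_norm_def by (intro ennreal_sqrt_mono nn_integral_mono power_mono) auto
  also have "\<dots> \<le> L2_L1_norm P D u + L2_L1_norm P D v"
    unfolding L2_L1_norm_def
    by (intro Minkowski_nn_integral_power2 borel_measurable_L1_norm D u v)
  finally show ?thesis .
qed

lemma L2_L1_norm_sum:
  assumes D: "D \<in> lmeasurable" and "finite I"
    and "\<And>i. i \<in> I \<Longrightarrow> (\<lambda>(\<omega>, x). u i \<omega> x) \<in> borel_measurable (P \<Otimes>\<^sub>M lebesgue_on D)"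
  shows "L2_L1_norm P D (\<lambda>\<omega> x. \<Sum>i\<in>I. u i \<omega> x) \<le> (\<Sum>i\<in>I. L2_L1_norm P D (u i))"
  using assms(2,3)
proof (induction I rule: finite_induct)
  case empty
  have "ennreal_sqrt 0 = 0"
    by (simp add: ennreal_sqrt_def)
  then show ?case
    by (simp add: L2_L1_norm_def L1_norm_def)
next
  case (insert i I)
  have "(\<lambda>(\<omega>, x). \<Sum>i\<in>I. u i \<omega> x) \<in> borel_measurable (P \<Otimes>\<^sub>M lebesgue_on D)"
    using insert.prems by (simp add: case_prod_beta')
  then have "L2_L1_norm P D (\<lambda>\<omega> x. u i \<omega> x + (\<Sum>i\<in>I. u i \<omega> x))
      \<le> L2_L1_norm P D (u i) + L2_L1_norm P D (\<lambda>\<omega> x. \<Sum>i\<in>I. u i \<omega> x)"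
    using insert.prems by (intro L2_L1_norm_triangle D) auto
  also have "\<dots> \<le> L2_L1_norm P D (u i) + (\<Sum>i\<in>I. L2_L1_norm P D (u i))"
    using insert by (intro add_left_mono insert.IH) auto
  finally show ?case
    using insert.hyps by simp
qed

section \<open>Second moments, sample means and averaged errors\<close>

lemma L2_L1_norm_le_second_moment:
  assumes D: "D \<in> lmeasurable" and "sigma_finite_measure P"
    and [measurable]: "(\<lambda>(\<omega>, x). u \<omega> x) \<in> borel_measurable (P \<Otimes>\<^sub>M lebesgue_on D)"
  shows "L2_L1_norm P D u \<le>
    ennreal_sqrt (emeasure lebesgue D * (\<integral>\<^sup>+x. \<integral>\<^sup>+\<omega>. ennreal ((u \<omega> x)\<^sup>2) \<partial>P \<partial>lebesgue_on D))"
proof -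
  interpret D: sigma_finite_measure "lebesgue_on D"
    by (rule sigma_finite_lebesgue_on) fact
  interpret P: sigma_finite_measure P by fact
  interpret pair_sigma_finite P "lebesgue_on D" ..
  have measD: "emeasure (lebesgue_on D) D = emeasure lebesgue D"
    using D by (simp add: emeasure_restrict_space fmeasurableD)
  \<comment> \<open>Cauchy-Schwarz against the constant 1, whose square integrates to |D|: this is
    where the measure of the domain enters.\<close>
  have "(L1_norm D (u \<omega>))\<^sup>2 \<le> emeasure lebesgue D * (\<integral>\<^sup>+x. ennreal ((u \<omega> x)\<^sup>2) \<partial>lebesgue_on D)"
    if [measurable]: "\<omega> \<in> space P" for \<omega>
  proof -
    have "(\<lambda>x. u \<omega> x) \<in> borel_measurable (lebesgue_on D)" by measurable
    then show ?thesis
      using Cauchy_Schwarz_nn_integral[of "\<lambda>x. ennreal \<bar>u \<omega> x\<bar>" "lebesgue_on D" "\<lambda>_. 1"]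
      by (simp add: L1_norm_def ennreal_power space_restrict_space measD mult.commute)
  qed
  then have "(\<integral>\<^sup>+\<omega>. (L1_norm D (u \<omega>))\<^sup>2 \<partial>P)
      \<le> (\<integral>\<^sup>+\<omega>. emeasure lebesgue D * (\<integral>\<^sup>+x. ennreal ((u \<omega> x)\<^sup>2) \<partial>lebesgue_on D) \<partial>P)"
    by (intro nn_integral_mono)
  also have "\<dots> = emeasure lebesgue D * (\<integral>\<^sup>+\<omega>. \<integral>\<^sup>+x. ennreal ((u \<omega> x)\<^sup>2) \<partial>lebesgue_on D \<partial>P)"
    by (intro nn_integral_cmult) measurable
  \<comment> \<open>The exchange puts the integral over \<open>P\<close> inside, where it is a
    second moment at fixed x.\<close>
  also have "(\<integral>\<^sup>+\<omega>. \<integral>\<^sup>+x. ennreal ((u \<omega> x)\<^sup>2) \<partial>lebesgue_on D \<partial>P)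
      = (\<integral>\<^sup>+x. \<integral>\<^sup>+\<omega>. ennreal ((u \<omega> x)\<^sup>2) \<partial>P \<partial>lebesgue_on D)"
    by (rule Fubini'[symmetric]) measurable
  finally show ?thesis
    unfolding L2_L1_norm_def by (rule ennreal_sqrt_mono)
qed

text \<open>The centred samples are pairwise uncorrelated, so only the n diagonal terms of the
  expanded square survive, and n times (1/n)^2 is 1/n. An infinite second moment makes the
  right-hand side infinite.\<close>

lemma (in prob_space) sample_mean_error_second_moment:
  fixes h :: "'d \<Rightarrow> real"
  assumes n: "n \<ge> 1" and iid: "iid_samples M S Z0 n Z"
    and Z0 [measurable]: "Z0 \<in> measurable M S" and h [measurable]: "h \<in> borel_measurable S"
    and int: "integrable M (\<lambda>\<omega>. h (Z0 \<omega>))"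
  shows "(\<integral>\<^sup>+\<omega>. ennreal ((expectation (\<lambda>\<omega>. h (Z0 \<omega>)) - 1 / real n * (\<Sum>i = 1..n. h (Z i \<omega>)))\<^sup>2) \<partial>M)
    \<le> ennreal (1 / real n) * evariance M (\<lambda>\<omega>. h (Z0 \<omega>))"
proof (cases "(\<integral>\<^sup>+\<omega>. ennreal ((h (Z0 \<omega>))\<^sup>2) \<partial>M) = \<infinity>")
  case True
  \<comment> \<open>In \<open>evariance\<close> a finite square is subtracted from infinity, which
    leaves infinity, and the factor 1/n is positive.\<close>
  then have "ennreal (1 / real n) * evariance M (\<lambda>\<omega>. h (Z0 \<omega>)) = \<infinity>"
    using n by (simp add: evariance_def ennreal_mult_eq_top_iff ennreal_eq_0_iff)
  then show ?thesis by simp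
next
  case False
  define m where "m = expectation (\<lambda>\<omega>. h (Z0 \<omega>))"
  \<comment> \<open>Centring is a function of the datum, so that the same \<open>w\<close> can be
    composed with \<open>Z0\<close> and with every sample.\<close>
  define w where "w = (\<lambda>g. m - h g)"
  have w [measurable]: "w \<in> borel_measurable S" unfolding w_def by simp
  have indep: "indep_vars (\<lambda>_. S) Z {1..n}"
    and dist: "\<And>i. i \<in> {1..n} \<Longrightarrow> distr M S (Z i) = distr M S Z0"
    using iid by (auto simp: iid_samples_def)
  have Z [measurable]: "i \<in> {1..n} \<Longrightarrow> Z i \<in> measurable M S" for i
    using indep by (auto simp: indep_vars_def)
  \<comment> \<open>Both sides are integrals of \<open>k\<close> against the common law on
    \<open>S\<close>. The test function is left open because \<open>w\<close> and its square are
    both needed.\<close>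
  have transfer_int: "integrable M (\<lambda>\<omega>. k (Z i \<omega>)) \<longleftrightarrow> integrable M (\<lambda>\<omega>. k (Z0 \<omega>))"
    and transfer: "expectation (\<lambda>\<omega>. k (Z i \<omega>)) = expectation (\<lambda>\<omega>. k (Z0 \<omega>))"
    if i: "i \<in> {1..n}" and [measurable]: "k \<in> borel_measurable S" for i and k :: "'d \<Rightarrow> real"
    using dist[OF i] Z[OF i] Z0 that(2)
    by (metis integrable_distr_eq, metis integral_distr)
  have sq: "integrable M (\<lambda>\<omega>. (h (Z0 \<omega>))\<^sup>2)"
    using False by (intro integrableI_nonneg) (auto simp: less_top)
  have w_int: "integrable M (\<lambda>\<omega>. w (Z0 \<omega>))" and w_0: "expectation (\<lambda>\<omega>. w (Z0 \<omega>)) = 0"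
    using int by (simp_all add: w_def m_def prob_space)
  have w_sq_int: "integrable M (\<lambda>\<omega>. (w (Z0 \<omega>))\<^sup>2)"
    using int sq by (simp add: w_def power2_diff)
  \<comment> \<open>Both terms of \<open>evariance\<close> are finite here, so its subtraction is
    that of the reals.\<close>
  have V: "evariance M (\<lambda>\<omega>. h (Z0 \<omega>)) = ennreal (expectation (\<lambda>\<omega>. (w (Z0 \<omega>))\<^sup>2))"
  proof -
    have "expectation (\<lambda>\<omega>. (w (Z0 \<omega>))\<^sup>2) = expectation (\<lambda>\<omega>. (h (Z0 \<omega>))\<^sup>2) - m\<^sup>2"
      using int sq variance_eq[OF int sq] by (simp add: w_def m_def power2_commute)
    then show ?thesis
      using sq by (simp add: evariance_def m_def nn_integral_eq_integral ennreal_minus)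
  qed
  have wi_int: "integrable M (\<lambda>\<omega>. w (Z i \<omega>))" if "i \<in> {1..n}" for i
    using transfer_int[OF that w] w_int by simp
  have cov: "integrable M (\<lambda>\<omega>. w (Z i \<omega>) * w (Z j \<omega>)) \<and>
      expectation (\<lambda>\<omega>. w (Z i \<omega>) * w (Z j \<omega>)) =
        (if i = j then expectation (\<lambda>\<omega>. (w (Z0 \<omega>))\<^sup>2) else 0)"
    if i: "i \<in> {1..n}" and j: "j \<in> {1..n}" for i j
  proof (cases "i = j")
    case True
    then show ?thesis
      using transfer_int[OF i, of "\<lambda>g. (w g)\<^sup>2"] transfer[OF i, of "\<lambda>g. (w g)\<^sup>2"] w_sq_int
      by (simp add: power2_eq_square)
  next
    case False
    \<comment> \<open>Independence makes the product integrable from first moments alone and factors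
      its mean, which then vanishes by centring.\<close>
    have "indep_vars (\<lambda>_. borel) (\<lambda>k \<omega>. w (Z k \<omega>)) {i, j}"
      using i j w
      by (intro indep_vars_compose2[OF indep_vars_subset[OF indep], where Y = "\<lambda>_. w"]) auto
    then have "integrable M (\<lambda>\<omega>. \<Prod>k\<in>{i, j}. w (Z k \<omega>))"
      and "expectation (\<lambda>\<omega>. \<Prod>k\<in>{i, j}. w (Z k \<omega>)) = (\<Prod>k\<in>{i, j}. expectation (\<lambda>\<omega>. w (Z k \<omega>)))"
      using wi_int i j by (intro indep_vars_integrable indep_vars_lebesgue_integral; force)+
    moreover have "expectation (\<lambda>\<omega>. w (Z i \<omega>)) = 0"
      using transfer[OF i w] w_0 by simp
    ultimately show ?thesis
      using False by simp
  qed
  \<comment> \<open>The constant \<open>m\<close> is written as the average of n copies of itself,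
    which uses that n is positive.\<close>
  have err: "m - 1 / real n * (\<Sum>i = 1..n. h (Z i \<omega>)) = 1 / real n * (\<Sum>i = 1..n. w (Z i \<omega>))" for \<omega>
    using n by (simp add: w_def sum_subtractf field_simps)
  have err_sq: "(m - 1 / real n * (\<Sum>i = 1..n. h (Z i \<omega>)))\<^sup>2
      = (1 / real n)\<^sup>2 * (\<Sum>i = 1..n. \<Sum>j = 1..n. w (Z i \<omega>) * w (Z j \<omega>))" for \<omega>
    unfolding err power_mult_distrib by (simp add: power2_eq_square sum_product)
  have "(\<integral>\<^sup>+\<omega>. ennreal ((m - 1 / real n * (\<Sum>i = 1..n. h (Z i \<omega>)))\<^sup>2) \<partial>M)
      = ennreal (expectation (\<lambda>\<omega>. (m - 1 / real n * (\<Sum>i = 1..n. h (Z i \<omega>)))\<^sup>2))"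
  proof (rule nn_integral_eq_integral)
    show "integrable M (\<lambda>\<omega>. (m - 1 / real n * (\<Sum>i = 1..n. h (Z i \<omega>)))\<^sup>2)"
      unfolding err_sq by (intro integrable_mult_right Bochner_Integration.integrable_sum conjunct1[OF cov])
  qed simp
  also have "expectation (\<lambda>\<omega>. (m - 1 / real n * (\<Sum>i = 1..n. h (Z i \<omega>)))\<^sup>2)
      = (1 / real n)\<^sup>2 * (\<Sum>i = 1..n. \<Sum>j = 1..n. expectation (\<lambda>\<omega>. w (Z i \<omega>) * w (Z j \<omega>)))"
    unfolding err_sq using cov
    by (subst integral_mult_right_zero, subst Bochner_Integration.integral_sum)
      (auto intro!: Bochner_Integration.integrable_sum arg_cong2[of _ _ _ _ "(*)"] sum.cong
        Bochner_Integration.integral_sum simp del: One_nat_def mult_cancel_left)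
  also have "(\<Sum>i = 1..n. \<Sum>j = 1..n. expectation (\<lambda>\<omega>. w (Z i \<omega>) * w (Z j \<omega>)))
      = (\<Sum>i = 1..n. \<Sum>j = 1..n. if i = j then expectation (\<lambda>\<omega>. (w (Z0 \<omega>))\<^sup>2) else 0)"
    by (intro sum.cong refl conjunct2[OF cov])
  also have "\<dots> = real n * expectation (\<lambda>\<omega>. (w (Z0 \<omega>))\<^sup>2)"
    by simp
  also have "(1 / real n)\<^sup>2 * \<dots> = 1 / real n * expectation (\<lambda>\<omega>. (w (Z0 \<omega>))\<^sup>2)"
    using n by (simp add: power2_eq_square)
  finally show ?thesis
    unfolding V by (simp add: m_def flip: ennreal_mult')
qed

text \<open>The absolute value moves inside the expectation, and Tonelli's theorem turns the result
  into the mean of the norms, an average of numbers at most \<open>c\<close>.\<close>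

lemma L1_norm_expectation_le:
  assumes "prob_space P" and D: "D \<in> lmeasurable"
    and [measurable]: "(\<lambda>(\<omega>, x). u \<omega> x) \<in> borel_measurable (P \<Otimes>\<^sub>M lebesgue_on D)"
    and bound: "\<And>\<omega>. \<omega> \<in> space P \<Longrightarrow> L1_norm D (u \<omega>) \<le> c"
  shows "L1_norm D (\<lambda>x. \<integral>\<omega>. u \<omega> x \<partial>P) \<le> c"
proof -
  interpret P: prob_space P by fact
  interpret D: sigma_finite_measure "lebesgue_on D"
    by (rule sigma_finite_lebesgue_on) fact
  interpret pair_sigma_finite P "lebesgue_on D" ..
  \<comment> \<open>Where \<open>u\<close> is not integrable the Bochner integral has the default
    value 0, so the inequality holds at every x.\<close>
  have "ennreal \<bar>\<integral>\<omega>. u \<omega> x \<partial>P\<bar> \<le> (\<integral>\<^sup>+\<omega>. ennreal \<bar>u \<omega> x\<bar> \<partial>P)" for x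
  proof (cases "integrable P (\<lambda>\<omega>. u \<omega> x)")
    case True
    then show ?thesis
      using integral_norm_bound_ennreal[OF True] by simp
  qed (simp add: not_integrable_integral_eq)
  then have "L1_norm D (\<lambda>x. \<integral>\<omega>. u \<omega> x \<partial>P) \<le> (\<integral>\<^sup>+x. \<integral>\<^sup>+\<omega>. ennreal \<bar>u \<omega> x\<bar> \<partial>P \<partial>lebesgue_on D)"
    unfolding L1_norm_def by (intro nn_integral_mono)
  also have "\<dots> = (\<integral>\<^sup>+\<omega>. L1_norm D (u \<omega>) \<partial>P)"
    unfolding L1_norm_def by (rule Fubini') measurable
  also have "\<dots> \<le> (\<integral>\<^sup>+\<omega>. c \<partial>P)"
    using bound by (intro nn_integral_mono) auto
  finally show ?thesis
    by (simp add: P.emeasure_space_1)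
qed

text \<open>This treats one level, with \<open>h\<close> standing for its level difference at the
  final time. Joint measurability comes along because the triangle inequality over the levels asks
  for it.\<close>

lemma sample_mean_error_L2_L1_norm:
  fixes h :: "'d \<Rightarrow> vec3 \<Rightarrow> real"
  assumes "prob_space P" and D: "D \<in> lmeasurable"
    and n: "n \<ge> 1" and iid: "iid_samples P S Z0 n Z" and Z0 [measurable]: "Z0 \<in> measurable P S"
    and h [measurable]: "(\<lambda>(g, x). h g x) \<in> borel_measurable (S \<Otimes>\<^sub>M lebesgue_on D)"
    and int: "AE x in lebesgue_on D. integrable P (\<lambda>\<omega>. h (Z0 \<omega>) x)"
  defines "u \<equiv> \<lambda>\<omega> x. (\<integral>\<omega>'. h (Z0 \<omega>') x \<partial>P) - 1 / real n * (\<Sum>i = 1..n. h (Z i \<omega>) x)"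
  shows "(\<lambda>(\<omega>, x). u \<omega> x) \<in> borel_measurable (P \<Otimes>\<^sub>M lebesgue_on D)"
    and "L2_L1_norm P D u \<le> ennreal (measure lebesgue D powr (1 / 2)) *
      (ennreal (real n powr (- 1 / 2)) *
       ennreal_sqrt (L1_norm_variance P D (\<lambda>\<omega> x. h (Z0 \<omega>) x)))"
proof -
  interpret P: prob_space P by fact
  have Z [measurable]: "i \<in> {1..n} \<Longrightarrow> Z i \<in> measurable P S" for i
    using iid by (auto simp: iid_samples_def P.indep_vars_def)
  show u [measurable]: "(\<lambda>(\<omega>, x). u \<omega> x) \<in> borel_measurable (P \<Otimes>\<^sub>M lebesgue_on D)"
    unfolding u_def by measurable
  let ?V = "L1_norm_variance P D (\<lambda>\<omega> x. h (Z0 \<omega>) x)"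
  have "AE x in lebesgue_on D. (\<integral>\<^sup>+\<omega>. ennreal ((u \<omega> x)\<^sup>2) \<partial>P)
      \<le> ennreal (1 / real n) * evariance P (\<lambda>\<omega>. h (Z0 \<omega>) x)"
    \<comment> \<open>Joint measurability yields a measurable section only at points of the space,
      so membership of x is carried along.\<close>
    using int AE_space
  proof eventually_elim
    case (elim x)
    then have [measurable]: "x \<in> space (lebesgue_on D)" by simp
    have "(\<lambda>g. h g x) \<in> borel_measurable S" by measurable
    then show ?case
      unfolding u_def using P.sample_mean_error_second_moment[OF n iid Z0 _ elim(1)] by simp
  qed
  then have "(\<integral>\<^sup>+x. \<integral>\<^sup>+\<omega>. ennreal ((u \<omega> x)\<^sup>2) \<partial>P \<partial>lebesgue_on D)
      \<le> (\<integral>\<^sup>+x. ennreal (1 / real n) * evariance P (\<lambda>\<omega>. h (Z0 \<omega>) x) \<partial>lebesgue_on D)"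
    by (rule nn_integral_mono_AE)
  also have "\<dots> = ennreal (1 / real n) * ?V"
    unfolding L1_norm_variance_def evariance_def by (intro nn_integral_cmult) measurable
  finally have "L2_L1_norm P D u
      \<le> ennreal_sqrt (emeasure lebesgue D * (ennreal (1 / real n) * ?V))"
    using L2_L1_norm_le_second_moment[OF D P.sigma_finite_measure_axioms u]
    by (meson ennreal_sqrt_mono mult_left_mono order_trans zero_le)
  also have "\<dots> = ennreal (measure lebesgue D powr (1 / 2)) *
      (ennreal ((1 / real n) powr (1 / 2)) * ennreal_sqrt ?V)"
    using D by (simp add: ennreal_sqrt_mult ennreal_sqrt_ennreal emeasure_eq_measure2)
  also have "(1 / real n) powr (1 / 2) = real n powr (- 1 / 2)"
    using n by (simp add: powr_divide powr_minus field_simps)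
  finally show "L2_L1_norm P D u \<le> ennreal (measure lebesgue D powr (1 / 2)) *
      (ennreal (real n powr (- 1 / 2)) * ennreal_sqrt ?V)" .
qed

section \<open>Decomposition of the error and assembly of the bound\<close>

theorem theorem4p1:
  fixes P :: "'w measure" and S :: "datum measure"
    and D B :: "vec3 set" and \<epsilon> t1 C_cfl C_w :: real
    and f0 :: "'w \<Rightarrow> datum" and f :: "'w \<Rightarrow> kinetic" and X :: "kinetic set"
    and q :: "kinetic \<Rightarrow> vec3 \<Rightarrow> real \<Rightarrow> real"
    and A :: scheme and T :: "nat \<Rightarrow> vec3 set set" and dt :: "nat \<Rightarrow> real"
    and L :: nat and M :: "nat \<Rightarrow> nat" and F :: "nat \<Rightarrow> nat \<Rightarrow> 'w \<Rightarrow> datum"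
  assumes prob: "prob_space P"
    and domain: "periodic_domain D B"
    and eps: "\<epsilon> > 0" and time: "t1 > 0"
    \<comment> \<open>random initial datum, exact solution and macroscopic quantity\<close>
    and f0_random: "f0 \<in> measurable P S"
    and f0_nonneg: "\<And>\<omega> x v. \<omega> \<in> space P \<Longrightarrow> f0 \<omega> x v \<ge> 0"
    and well_posed: "\<And>\<omega>. \<omega> \<in> space P \<Longrightarrow> bgk_well_posed X \<epsilon> B (f0 \<omega>)"
    and solution: "\<And>\<omega>. \<omega> \<in> space P \<Longrightarrow> f \<omega> \<in> X \<and> bgk_solution \<epsilon> B (f0 \<omega>) (f \<omega>)"
    and quantity: "q \<in> {mass_density, speed, temperature}"
    and q_measurable:
      "(\<lambda>(\<omega>, x). q (f \<omega>) x t1) \<in> borel_measurable (P \<Otimes>\<^sub>M lebesgue_on D)"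
    and q_expectation: "AE x in lebesgue_on D. integrable P (\<lambda>\<omega>. q (f \<omega>) x t1)"
    \<comment> \<open>nested meshes, time steps and numerical solutions\<close>
    and levels: "L \<ge> 1"
    and mesh: "\<And>l. l \<in> {1..L} \<Longrightarrow> is_mesh D (T l)"
    and nested: "\<And>l. l \<in> {1..<L} \<Longrightarrow>
      refines D (T (Suc l)) (T l) \<and> mesh_size (T (Suc l)) < mesh_size (T l)"
    and cfl: "\<And>l. l \<in> {1..L} \<Longrightarrow> 0 < dt l \<and> dt l \<le> C_cfl * mesh_size (T l)"
    and num_measurable: "\<And>l. l \<in> {1..L} \<Longrightarrow>
      (\<lambda>(g, x). A (T l) (dt l) g x t1) \<in> borel_measurable (S \<Otimes>\<^sub>M lebesgue_on D)"
    and num_expectation: "\<And>l. l \<in> {1..L} \<Longrightarrow>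
      AE x in lebesgue_on D. integrable P (\<lambda>\<omega>. A (T l) (dt l) (f0 \<omega>) x t1)"
    \<comment> \<open>samples\<close>
    and M_pos: "\<And>l. l \<in> {1..L} \<Longrightarrow> M l \<ge> 1"
    and samples: "\<And>l. l \<in> {1..L} \<Longrightarrow> iid_samples P S f0 (M l) (F l)"
    \<comment> \<open>second order error bound\<close>
    and C_w_nonneg: "C_w \<ge> 0"
    and error_bound: "\<And>\<omega> l. \<omega> \<in> space P \<Longrightarrow> l \<in> {1..L} \<Longrightarrow>
      L1_norm D (\<lambda>x. q (f \<omega>) x t1 - A (T l) (dt l) (f0 \<omega>) x t1)
        \<le> ennreal (C_w * (mesh_size (T l))\<^sup>2)"
  shows "L2_L1_norm P D
           (\<lambda>\<omega> x. (\<integral>\<omega>'. q (f \<omega>') x t1 \<partial>P) - mlmc_estimator A T dt L M F \<omega> x t1)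
         \<le> ennreal (C_w * (mesh_size (T L))\<^sup>2) +
           ennreal (measure lebesgue D powr (1 / 2)) *
           (\<Sum>l = 1..L. ennreal (real (M l) powr (- 1 / 2)) *
              ennreal_sqrt (L1_norm_variance P D (\<lambda>\<omega> x. level_diff A T dt l (f0 \<omega>) x t1)))"
proof -
  interpret P: prob_space P by (rule prob)
  have D: "D \<in> lmeasurable"
    using domain unfolding periodic_domain_def by (intro lmeasurable_open) auto
  \<comment> \<open>Level 0, where \<open>a\<close> vanishes, is included so that the facts below
    also cover the predecessor of level 1.\<close>
  define a where "a = (\<lambda>l g x. level_sol A T dt l g x t1)"
  define Y where "Y = (\<lambda>l g x. level_diff A T dt l g x t1)"
  have Y_a: "Y l g x = a l g x - a (l - 1) g x" for l g x
    by (simp add: Y_def a_def level_diff_def)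
  have a_meas [measurable]: "(\<lambda>(g, x). a l g x) \<in> borel_measurable (S \<Otimes>\<^sub>M lebesgue_on D)"
    if "l \<le> L" for l
    using num_measurable[of l] that by (cases "l = 0") (auto simp: a_def level_sol_def)
  have Y_meas: "(\<lambda>(g, x). Y l g x) \<in> borel_measurable (S \<Otimes>\<^sub>M lebesgue_on D)"
    if "l \<le> L" for l
    using borel_measurable_diff[OF a_meas[OF that] a_meas[of "l - 1"]] that
    by (simp add: Y_a case_prod_beta')
  have a_int: "AE x in lebesgue_on D. integrable P (\<lambda>\<omega>. a l (f0 \<omega>) x)" if "l \<le> L" for l
    using num_expectation[of l] that by (cases "l = 0") (auto simp: a_def level_sol_def)
  have Y_int: "AE x in lebesgue_on D. integrable P (\<lambda>\<omega>. Y l (f0 \<omega>) x)" if "l \<le> L" for l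
    using a_int[OF that] a_int[OF le_trans[OF diff_le_self that, of 1]]
    by eventually_elim (simp add: Y_a)
  \<comment> \<open>An expectation of a difference, not a difference of expectations:
    \<open>L1_norm_expectation_le\<close> then applies directly, and the two agree for almost every
    x.\<close>
  define bias where "bias = (\<lambda>x. \<integral>\<omega>. q (f \<omega>) x t1 - a L (f0 \<omega>) x \<partial>P)"
  define e where "e = (\<lambda>l \<omega> x. (\<integral>\<omega>'. Y l (f0 \<omega>') x \<partial>P)
      - 1 / real (M l) * (\<Sum>i = 1..M l. Y l (F l i \<omega>) x))"
  have e_meas: "(\<lambda>(\<omega>, x). e l \<omega> x) \<in> borel_measurable (P \<Otimes>\<^sub>M lebesgue_on D)"
    and e_bound: "L2_L1_norm P D (e l) \<le> ennreal (measure lebesgue D powr (1 / 2)) *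
      (ennreal (real (M l) powr (- 1 / 2)) *
       ennreal_sqrt (L1_norm_variance P D (\<lambda>\<omega> x. level_diff A T dt l (f0 \<omega>) x t1)))"
    if "l \<in> {1..L}" for l
  proof -
    have "l \<le> L" using that by simp
    note * = sample_mean_error_L2_L1_norm[where h = "Y l", OF prob D M_pos[OF that]
        samples[OF that] f0_random Y_meas[OF \<open>l \<le> L\<close>] Y_int[OF \<open>l \<le> L\<close>]]
    show "(\<lambda>(\<omega>, x). e l \<omega> x) \<in> borel_measurable (P \<Otimes>\<^sub>M lebesgue_on D)"
      unfolding e_def by (rule *)
    show "L2_L1_norm P D (e l) \<le> ennreal (measure lebesgue D powr (1 / 2)) *
      (ennreal (real (M l) powr (- 1 / 2)) *
       ennreal_sqrt (L1_norm_variance P D (\<lambda>\<omega> x. level_diff A T dt l (f0 \<omega>) x t1)))"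
      using *(2) unfolding e_def Y_def .
  qed
  have err_meas [measurable]:
    "(\<lambda>(\<omega>, x). q (f \<omega>) x t1 - a L (f0 \<omega>) x) \<in> borel_measurable (P \<Otimes>\<^sub>M lebesgue_on D)"
  proof -
    note [measurable] = q_measurable f0_random a_meas[OF order.refl]
    show ?thesis by measurable
  qed
  have bias_meas: "(\<lambda>(\<omega>, x). bias x) \<in> borel_measurable (P \<Otimes>\<^sub>M lebesgue_on D)"
    unfolding bias_def by measurable
  have bias_bound: "L1_norm D bias \<le> ennreal (C_w * (mesh_size (T L))\<^sup>2)"
    unfolding bias_def
  proof (rule L1_norm_expectation_le[OF prob D err_meas])
    fix \<omega> assume "\<omega> \<in> space P"
    \<comment> \<open>Since L is at least 1, \<open>a L\<close> is the scheme's output and not the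
      default 0.\<close>
    then show "L1_norm D (\<lambda>x. q (f \<omega>) x t1 - a L (f0 \<omega>) x) \<le> ennreal (C_w * (mesh_size (T L))\<^sup>2)"
      using error_bound[of \<omega> L] levels by (simp add: a_def level_sol_def)
  qed
  \<comment> \<open>Finitely many null sets merge into one. The range starts at 0, as the
    telescoping sum reaches down to \<open>a 0\<close>.\<close>
  have "AE x in lebesgue_on D. \<forall>l\<in>{..L}. integrable P (\<lambda>\<omega>. a l (f0 \<omega>) x)"
    using a_int by (intro AE_finite_allI) auto
  then have "AE x in lebesgue_on D. \<forall>\<omega>\<in>space P.
      (\<integral>\<omega>'. q (f \<omega>') x t1 \<partial>P) - mlmc_estimator A T dt L M F \<omega> x t1
        = bias x + (\<Sum>l = 1..L. e l \<omega> x)"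
    using q_expectation
  proof eventually_elim
    case (elim x)
    have "(\<Sum>l = 1..L. \<integral>\<omega>. Y l (f0 \<omega>) x \<partial>P)
        = (\<Sum>l = 1..L. (\<integral>\<omega>. a l (f0 \<omega>) x \<partial>P) - (\<integral>\<omega>. a (l - 1) (f0 \<omega>) x \<partial>P))"
      using elim(1) by (intro sum.cong) (auto simp: Y_a)
    also have "\<dots> = (\<integral>\<omega>. a L (f0 \<omega>) x \<partial>P) - (\<integral>\<omega>. a 0 (f0 \<omega>) x \<partial>P)"
      using sum_telescope''[of 0 L "\<lambda>l. \<integral>\<omega>. a l (f0 \<omega>) x \<partial>P"] by simp
    also have "\<dots> = (\<integral>\<omega>. a L (f0 \<omega>) x \<partial>P)"
      by (simp add: a_def level_sol_def)
    finally show ?case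
      using elim by (simp add: bias_def e_def mlmc_estimator_def Y_def sum_subtractf)
  qed
  then have "L2_L1_norm P D
      (\<lambda>\<omega> x. (\<integral>\<omega>'. q (f \<omega>') x t1 \<partial>P) - mlmc_estimator A T dt L M F \<omega> x t1)
      = L2_L1_norm P D (\<lambda>\<omega> x. bias x + (\<Sum>l = 1..L. e l \<omega> x))"
    by (rule L2_L1_norm_cong_AE)
  also have "\<dots> \<le> L2_L1_norm P D (\<lambda>\<omega>. bias) + L2_L1_norm P D (\<lambda>\<omega> x. \<Sum>l = 1..L. e l \<omega> x)"
    using e_meas by (intro L2_L1_norm_triangle D bias_meas) (simp add: case_prod_beta')
  \<comment> \<open>The levels are separated by the triangle inequality and not by adding variances;
    hence the sum of square roots in the bound.\<close>
  also have "\<dots> \<le> L1_norm D bias + (\<Sum>l = 1..L. L2_L1_norm P D (e l))"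
    using e_meas unfolding L2_L1_norm_const[OF prob]
    by (intro add_left_mono L2_L1_norm_sum D) auto
  also have "\<dots> \<le> ennreal (C_w * (mesh_size (T L))\<^sup>2) +
      (\<Sum>l = 1..L. ennreal (measure lebesgue D powr (1 / 2)) *
        (ennreal (real (M l) powr (- 1 / 2)) *
         ennreal_sqrt (L1_norm_variance P D (\<lambda>\<omega> x. level_diff A T dt l (f0 \<omega>) x t1))))"
    by (intro add_mono bias_bound sum_mono e_bound)
  finally show ?thesis
    by (simp add: sum_distrib_left)
qed

end
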